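(* Let $c\in(0,\tfrac12]$. There exists a sequence of pairs of graphs $\{(F_{n_i},G_{n_i})\}_{i\ge1}$, where $F_{n_i}$ and $G_{n_i}$ both have $n_i$ vertices, such that \[\lim_{i\to\infty}\frac{\mathcal{RH}(F_{n_i},G_{n_i})}{n_i}=c.\]
   Context: All graphs are finite, simple, and have no isolated vertices. For a graph $H$, $\Delta(H)$ is its maximum degree, $f_H(k)=|\{v: d(v)\ge k\}|$ for integers $k\ge1$, and the smooth ccdh is the piecewise-linear interpolation $\varphi_H(x)=(1-(x-\lfloor x\rfloor))f_H(\lfloor x\rfloor)+(x-\lfloor x\rfloor)f_H(\lfloor x\rfloor+1)$ for real $x\ge1$. The smooth directional Relative Hausdorff distance $\mathcal{RH}_r(F,G)$ is the minimum $\epsilon\ge0$ such that for every integer $d\in\{1,\dots,\Delta(F)\}$ there is a real $d'\in[1,\Delta(G)+1]$ with $|d-d'|\le\epsilon d$ and $|\varphi_F(d)-\varphi_G(d')|\le\epsilon\varphi_F(d)$; and $\mathcal{RH}(F,G)=\max\{\mathcal{RH}_r(F,G),\mathcal{RH}_r(G,F)\}$. *)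

theory Defs
  imports "HOL-Analysis.Analysis" "Graph_Theory.Pair_Digraph"
begin

text \<open>
  Finite simple undirected graphs are the symmetric loop-free arc relations of the locale
  \<^const>\<open>pair_graph\<close>: an edge between u and v is the pair of arcs (u, v) and (v, u).  Hence the
  degree of a vertex is its out-degree (equivalently, its in-degree), not the sum of the two.
\<close>

definition degree :: "'a pair_pre_digraph \<Rightarrow> 'a \<Rightarrow> nat" where
  "degree H v = out_degree (with_proj H) v"

definition simple_graph_no_isolated :: "'a pair_pre_digraph \<Rightarrow> bool" where
  "simple_graph_no_isolated H \<longleftrightarrow>
     pair_graph H \<and> pverts H \<noteq> {} \<and> (\<forall>v\<in>pverts H. \<exists>w. (v, w) \<in> parcs H)"

definition max_degree :: "'a pair_pre_digraph \<Rightarrow> nat" where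
  "max_degree H = Max (degree H ` pverts H)"

definition ccdh :: "'a pair_pre_digraph \<Rightarrow> nat \<Rightarrow> nat" where
  "ccdh H k = card {v \<in> pverts H. k \<le> degree H v}"

definition smooth_ccdh :: "'a pair_pre_digraph \<Rightarrow> real \<Rightarrow> real" where
  "smooth_ccdh H x =
     (1 - (x - of_int \<lfloor>x\<rfloor>)) * real (ccdh H (nat \<lfloor>x\<rfloor>))
     + (x - of_int \<lfloor>x\<rfloor>) * real (ccdh H (nat \<lfloor>x\<rfloor> + 1))"

definition RH_dir_bound :: "'a pair_pre_digraph \<Rightarrow> 'b pair_pre_digraph \<Rightarrow> real \<Rightarrow> bool" where
  "RH_dir_bound F G \<epsilon> \<longleftrightarrow>
     0 \<le> \<epsilon> \<and>
     (\<forall>d\<in>{1..max_degree F}. \<exists>d'\<in>{1..real (max_degree G) + 1}.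
        \<bar>real d - d'\<bar> \<le> \<epsilon> * real d \<and>
        \<bar>smooth_ccdh F (real d) - smooth_ccdh G d'\<bar> \<le> \<epsilon> * smooth_ccdh F (real d))"

definition RH_dir :: "'a pair_pre_digraph \<Rightarrow> 'b pair_pre_digraph \<Rightarrow> real" where
  "RH_dir F G = (LEAST \<epsilon>. RH_dir_bound F G \<epsilon>)"

definition RH :: "'a pair_pre_digraph \<Rightarrow> 'b pair_pre_digraph \<Rightarrow> real" where
  "RH F G = max (RH_dir F G) (RH_dir G F)"

text \<open>The rest of this theory shows that the minimum in the definition of \<^const>\<open>RH_dir\<close> is attained.\<close>

lemma smooth_ccdh_of_nat: "smooth_ccdh H (real d) = real (ccdh H d)"
  by (simp add: smooth_ccdh_def)

lemma smooth_ccdh_linear: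
  assumes "x \<in> {real k..real k + 1}"
  shows "smooth_ccdh H x = (1 - (x - real k)) * real (ccdh H k) + (x - real k) * real (ccdh H (k + 1))"
proof (cases "x = real k + 1")
  case True
  then have "x = real (k + 1)" by simp
  then show ?thesis by (simp only: smooth_ccdh_of_nat) simp
next
  case False
  with assms have "\<lfloor>x\<rfloor> = int k" by (intro floor_unique) auto
  then show ?thesis by (simp add: smooth_ccdh_def)
qed

lemma continuous_on_smooth_ccdh: "continuous_on {1..real m + 1} (smooth_ccdh H)"
proof -
  have "continuous_on (\<Union>k\<in>{0..m}. {real k..real k + 1}) (smooth_ccdh H)"
  proof (rule continuous_on_closed_Union)
    fix k
    have "continuous_on {real k..real k + 1}
      (\<lambda>x. (1 - (x - real k)) * real (ccdh H k) + (x - real k) * real (ccdh H (k + 1)))"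
      by (intro continuous_intros)
    then show "continuous_on {real k..real k + 1} (smooth_ccdh H)"
      by (rule continuous_on_eq) (rule smooth_ccdh_linear[symmetric])
  qed auto
  moreover have "{1..real m + 1} \<subseteq> (\<Union>k\<in>{0..m}. {real k..real k + 1})"
  proof
    fix x assume x: "x \<in> {1..real m + 1}"
    show "x \<in> (\<Union>k\<in>{0..m}. {real k..real k + 1})"
    proof (cases "x = real m + 1")
      case True
      then show ?thesis by force
    next
      case False
      with x have "nat \<lfloor>x\<rfloor> \<le> m" "real (nat \<lfloor>x\<rfloor>) \<le> x" "x \<le> real (nat \<lfloor>x\<rfloor>) + 1"
        by (simp_all add: nat_le_iff floor_le_iff)
      then show ?thesis by (intro UN_I[of "nat \<lfloor>x\<rfloor>"]) simp_all
    qed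
  qed
  ultimately show ?thesis by (rule continuous_on_subset)
qed

lemma ccdh_pos:
  assumes "simple_graph_no_isolated H" "d \<le> max_degree H"
  shows "0 < ccdh H d"
proof -
  interpret pair_graph H using assms(1) by (simp add: simple_graph_no_isolated_def)
  have "max_degree H \<in> degree H ` pverts H"
    unfolding max_degree_def using assms(1) pair_finite_verts
    by (intro Max_in) (auto simp: simple_graph_no_isolated_def)
  with assms(2) have "{v \<in> pverts H. d \<le> degree H v} \<noteq> {}" by auto
  then show ?thesis
    unfolding ccdh_def using pair_finite_verts by (simp add: card_gt_0_iff)
qed

lemma RH_dir_minimum:
  assumes F: "simple_graph_no_isolated F"
  shows "RH_dir_bound F G (RH_dir F G)"
    and "\<And>\<epsilon>. RH_dir_bound F G \<epsilon> \<Longrightarrow> RH_dir F G \<le> \<epsilon>"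
proof -
  define I where "I = {1..real (max_degree G) + 1}"
  define h where "h d d' = max (\<bar>real d - d'\<bar> / real d)
    (\<bar>smooth_ccdh F (real d) - smooth_ccdh G d'\<bar> / smooth_ccdh F (real d))" for d :: nat and d' :: real
  define D where "D = {1..max_degree F}"
  have pos: "0 < smooth_ccdh F (real d)" "0 < real d" if "d \<in> D" for d
    using that ccdh_pos[OF F] by (auto simp: smooth_ccdh_of_nat D_def)
  have h_iff: "h d d' \<le> \<epsilon> \<longleftrightarrow> \<bar>real d - d'\<bar> \<le> \<epsilon> * real d \<and>
      \<bar>smooth_ccdh F (real d) - smooth_ccdh G d'\<bar> \<le> \<epsilon> * smooth_ccdh F (real d)"
    if "d \<in> D" for d d' \<epsilon>
    using pos[OF that] by (simp add: h_def pos_divide_le_eq)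
  have "\<exists>t\<in>I. \<forall>y\<in>I. h d t \<le> h d y" for d
  proof (rule continuous_attains_inf)
    show "continuous_on I (h d)"
      unfolding h_def I_def divide_inverse
      by (intro continuous_intros continuous_on_smooth_ccdh)
  qed (auto simp: I_def)
  then obtain t where t: "\<And>d. t d \<in> I" "\<And>d y. y \<in> I \<Longrightarrow> h d (t d) \<le> h d y" by metis
  define m where "m = Max (insert 0 ((\<lambda>d. h d (t d)) ` D))"
  have bound_iff: "RH_dir_bound F G \<epsilon> \<longleftrightarrow> m \<le> \<epsilon>" for \<epsilon>
  proof -
    have "RH_dir_bound F G \<epsilon> \<longleftrightarrow> 0 \<le> \<epsilon> \<and> (\<forall>d\<in>D. \<exists>d'\<in>I. h d d' \<le> \<epsilon>)"
      unfolding RH_dir_bound_def D_def[symmetric] I_def[symmetric] by (simp add: h_iff)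
    also have "\<dots> \<longleftrightarrow> 0 \<le> \<epsilon> \<and> (\<forall>d\<in>D. h d (t d) \<le> \<epsilon>)"
      using t(1) order_trans[OF t(2)] by blast
    also have "\<dots> \<longleftrightarrow> m \<le> \<epsilon>"
      by (simp add: m_def D_def)
    finally show ?thesis .
  qed
  have "RH_dir F G = m"
    unfolding RH_dir_def by (rule Least_equality) (simp_all add: bound_iff)
  then show "RH_dir_bound F G (RH_dir F G)"
    and "\<And>\<epsilon>. RH_dir_bound F G \<epsilon> \<Longrightarrow> RH_dir F G \<le> \<epsilon>"
    by (simp_all add: bound_iff)
qed

end

theory Submission
  imports Defs
begin

text \<open>
  Let F be the star on n vertices and let G be obtained from it by completing m of its vertices,
  the centre among them, to a clique.  The ccdh of F drops to 1 at degree 2, whereas that of G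
  stays at least m up to degree m - 1.  Matching the degree d = 2 of F therefore costs either a
  relative error m - 1 in the ccdh or a displacement of about m in the degree, that is a relative
  error of about m / 2.  All other degrees are matched more cheaply, so RH(F, G) differs from m / 2
  by a bounded amount, and m is taken to be the integer part of 2cn.
\<close>

text \<open>Vertex 0 is the centre. For m \<le> 2 this is the plain star, so both graphs of a pair
  come from one family; the star is taken as m = 0.\<close>

definition clique_star :: "nat \<Rightarrow> nat \<Rightarrow> nat pair_pre_digraph" where
  "clique_star n m = \<lparr>pverts = {..<n},
     parcs = {(u, v). u < n \<and> v < n \<and> u \<noteq> v \<and> (u = 0 \<or> v = 0 \<or> (u < m \<and> v < m))}\<rparr>"

lemma pverts_clique_star [simp]: "pverts (clique_star n m) = {..<n}"
  by (simp add: clique_star_def)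

lemma degree_eq_card_neighbours: "degree H v = card {w. (v, w) \<in> parcs H}"
proof -
  have "out_arcs (with_proj H) v = Pair v ` {w. (v, w) \<in> parcs H}"
    by (auto simp: out_arcs_def)
  then show ?thesis
    by (simp add: degree_def out_degree_def card_image inj_on_def)
qed

lemma degree_clique_star:
  assumes "v < n" "m \<le> n"
  shows "degree (clique_star n m) v = (if v = 0 then n - 1 else if v < m then m - 1 else 1)"
proof -
  have "{w. (v, w) \<in> parcs (clique_star n m)} =
      (if v = 0 then {..<n} - {v} else if v < m then {..<m} - {v} else {0})"
    using assms by (auto simp: clique_star_def)
  then show ?thesis
    using assms by (simp add: degree_eq_card_neighbours)
qed

lemma simple_graph_clique_star:
  assumes "2 \<le> n"
  shows "simple_graph_no_isolated (clique_star n m)"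
proof -
  have "finite (parcs (clique_star n m))"
    by (rule finite_subset[of _ "{..<n} \<times> {..<n}"]) (auto simp: clique_star_def)
  then have "pair_graph (clique_star n m)"
    by unfold_locales (auto simp: clique_star_def symmetric_def arcs_ends_def arc_to_ends_def
        intro!: symI)
  moreover have "\<exists>w. (v, w) \<in> parcs (clique_star n m)" if "v < n" for v
    using assms that by (intro exI[of _ "if v = 0 then 1 else 0"]) (auto simp: clique_star_def)
  ultimately show ?thesis
    using assms by (simp add: simple_graph_no_isolated_def lessThan_empty_iff)
qed

lemma max_degree_clique_star:
  assumes "2 \<le> n" "m \<le> n"
  shows "max_degree (clique_star n m) = n - 1"
  unfolding max_degree_def
proof (rule Max_eqI)
  show "n - 1 \<in> degree (clique_star n m) ` pverts (clique_star n m)"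
    using assms by (intro image_eqI[of _ _ 0]) (auto simp: degree_clique_star)
qed (use assms in \<open>auto simp: degree_clique_star split: if_splits\<close>)

lemma ccdh_clique_star:
  assumes "2 \<le> n" "m \<le> n"
  shows "ccdh (clique_star n m) d =
    (if d \<le> 1 then n else if d < m then m else if d < n then 1 else 0)"
proof -
  have "{v \<in> pverts (clique_star n m). d \<le> degree (clique_star n m) v} =
      {v. v < n \<and> d \<le> (if v = 0 then n - 1 else if v < m then m - 1 else 1)}"
    using assms by (auto simp: degree_clique_star)
  also have "\<dots> = (if d \<le> 1 then {..<n} else if d < m then {..<m} else if d < n then {0} else {})"
    using assms by (auto split: if_splits)
  finally show ?thesis
    by (simp add: ccdh_def)
qed

lemma ccdh_antimono:
  assumes "finite (pverts H)" "j \<le> k"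
  shows "ccdh H k \<le> ccdh H j"
  unfolding ccdh_def using assms by (intro card_mono) auto

text \<open>Below p the smooth ccdh interpolates between values at integers up to p, all at least
  the value at p. This is needed because degrees may be matched to non-integral points.\<close>

lemma ccdh_le_smooth_ccdh:
  assumes fin: "finite (pverts H)" and x: "0 \<le> x" "x \<le> real p"
  shows "real (ccdh H p) \<le> smooth_ccdh H x"
proof (cases "x = real p")
  case True
  then show ?thesis by (simp add: smooth_ccdh_of_nat)
next
  case False
  define k where "k = nat \<lfloor>x\<rfloor>"
  have k: "x \<in> {real k..real k + 1}" using x by (auto simp: k_def)
  have "real k < real p" using k x False by auto
  then have "k + 1 \<le> p" by simp
  then have "real (ccdh H p) \<le> real (ccdh H k)" "real (ccdh H p) \<le> real (ccdh H (k + 1))"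
    by (intro of_nat_mono ccdh_antimono[OF fin]; simp)+
  \<comment> \<open>The left side is \<open>ccdh H p\<close> written as a convex combination of
    itself, so the two sides compare term by term.\<close>
  then have "(1 - (x - real k)) * real (ccdh H p) + (x - real k) * real (ccdh H p)
      \<le> (1 - (x - real k)) * real (ccdh H k) + (x - real k) * real (ccdh H (k + 1))"
    using k by (intro add_mono mult_left_mono) auto
  then show ?thesis
    unfolding smooth_ccdh_linear[OF k] by (simp add: algebra_simps)
qed

lemma RH_dir_bound_star_lower:
  assumes "2 \<le> n" "m \<le> n" and bound: "RH_dir_bound (clique_star n 0) (clique_star n m) \<epsilon>"
  shows "real m / 2 - 3 / 2 \<le> \<epsilon>"
proof (cases "m < 3")
  case True
  \<comment> \<open>Here the claimed bound is negative.\<close>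
  then show ?thesis using bound by (simp add: RH_dir_bound_def)
next
  case False
  then have "2 \<in> {1..max_degree (clique_star n 0)}"
    using assms by (simp add: max_degree_clique_star)
  with bound obtain x where x: "1 \<le> x" "\<bar>real 2 - x\<bar> \<le> \<epsilon> * real 2"
    "\<bar>smooth_ccdh (clique_star n 0) (real 2) - smooth_ccdh (clique_star n m) x\<bar>
      \<le> \<epsilon> * smooth_ccdh (clique_star n 0) (real 2)"
    unfolding RH_dir_bound_def by fastforce
  \<comment> \<open>Since the value is 1, \<epsilon> bounds the absolute error in the ccdh.\<close>
  have "smooth_ccdh (clique_star n 0) (real 2) = 1"
    unfolding smooth_ccdh_of_nat using assms False by (simp add: ccdh_clique_star)
  with x(3) have close: "smooth_ccdh (clique_star n m) x \<le> 1 + \<epsilon>" by simp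
  show ?thesis
  proof (cases "x \<le> real (m - 1)")
    case True
    then have "real (ccdh (clique_star n m) (m - 1)) \<le> smooth_ccdh (clique_star n m) x"
      using x(1) by (intro ccdh_le_smooth_ccdh) auto
    moreover have "ccdh (clique_star n m) (m - 1) = m"
      using False unfolding ccdh_clique_star[OF assms(1,2)] by simp linarith
    ultimately show ?thesis using close False by simp
  next
    case no: False
    \<comment> \<open>Now x > m - 1, so 2 \<epsilon> \<ge> x - 2 > m - 3, whence the constant
      3/2.\<close>
    then show ?thesis using x(2) False by simp
  qed
qed

lemma RH_dir_bound_star_upper:
  assumes "2 \<le> n" "m \<le> n"
  shows "RH_dir_bound (clique_star n 0) (clique_star n m) (real m / 2 + 1)"
  unfolding RH_dir_bound_def
proof (intro conjI ballI)
  fix d assume "d \<in> {1..max_degree (clique_star n 0)}"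
  then have d: "1 \<le> d" "d < n" using assms by (auto simp: max_degree_clique_star)
  \<comment> \<open>Degrees strictly between 1 and m move up to m, where the second ccdh has dropped
    to 1, or to 0 if m = n; all others stay. The value e = n is allowed, being the maximum degree
    plus 1.\<close>
  define e where "e = (if d = 1 then 1 else max d m)"
  have e: "e \<in> {1..n}" using d assms by (auto simp: e_def)
  have "\<bar>real d - real e\<bar> \<le> (real m / 2 + 1) * real d"
  proof (cases "2 \<le> d \<and> d < m")
    case True
    \<comment> \<open>Since d \<ge> 2, an error of m / 2 relative to d allows a displacement of
      m.\<close>
    have "real m / 2 * 2 \<le> real m / 2 * real d"
      using True by (intro mult_left_mono) auto
    moreover have "e = m" "real d \<le> real m" using True by (auto simp: e_def)
    ultimately show ?thesis unfolding distrib_right by linarith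
  next
    case False
    then have "e = d" using d by (auto simp: e_def)
    then show ?thesis by simp
  qed
  moreover have "\<bar>real (ccdh (clique_star n 0) d) - real (ccdh (clique_star n m) e)\<bar>
      \<le> (real m / 2 + 1) * real (ccdh (clique_star n 0) d)"
    using d assms by (auto simp: e_def ccdh_clique_star)
  ultimately show "\<exists>d'\<in>{1..real (max_degree (clique_star n m)) + 1}.
      \<bar>real d - d'\<bar> \<le> (real m / 2 + 1) * real d \<and>
      \<bar>smooth_ccdh (clique_star n 0) (real d) - smooth_ccdh (clique_star n m) d'\<bar>
        \<le> (real m / 2 + 1) * smooth_ccdh (clique_star n 0) (real d)"
    using e assms
    by (intro bexI[of _ "real e"])
      (auto simp: smooth_ccdh_of_nat max_degree_clique_star of_nat_diff)
qed simp

text \<open>Every degree is matched to itself: the smaller ccdh of the star lies between 0 and that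
  of the other graph, so the relative error is at most 1.\<close>

lemma RH_dir_bound_to_star:
  assumes "2 \<le> n" "m \<le> n"
  shows "RH_dir_bound (clique_star n m) (clique_star n 0) 1"
  unfolding RH_dir_bound_def
proof (intro conjI ballI)
  fix d assume "d \<in> {1..max_degree (clique_star n m)}"
  then have d: "1 \<le> d" "d < n" using assms by (auto simp: max_degree_clique_star)
  have "ccdh (clique_star n 0) d \<le> ccdh (clique_star n m) d"
    using d assms by (simp add: ccdh_clique_star)
  then show "\<exists>d'\<in>{1..real (max_degree (clique_star n 0)) + 1}.
      \<bar>real d - d'\<bar> \<le> 1 * real d \<and>
      \<bar>smooth_ccdh (clique_star n m) (real d) - smooth_ccdh (clique_star n 0) d'\<bar>
        \<le> 1 * smooth_ccdh (clique_star n m) (real d)"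
    using d assms
    by (intro bexI[of _ "real d"])
      (auto simp: smooth_ccdh_of_nat max_degree_clique_star of_nat_diff)
qed simp

lemma RH_clique_star_bounds:
  assumes "2 \<le> n" "m \<le> n"
  shows "real m / 2 - 3 / 2 \<le> RH (clique_star n 0) (clique_star n m)"
    and "RH (clique_star n 0) (clique_star n m) \<le> real m / 2 + 1"
proof -
  note min = RH_dir_minimum[OF simple_graph_clique_star[OF assms(1)]]
  show "real m / 2 - 3 / 2 \<le> RH (clique_star n 0) (clique_star n m)"
    unfolding RH_def using RH_dir_bound_star_lower[OF assms min(1)] by simp
  show "RH (clique_star n 0) (clique_star n m) \<le> real m / 2 + 1"
    unfolding RH_def
    using min(2)[OF RH_dir_bound_star_upper[OF assms]] min(2)[OF RH_dir_bound_to_star[OF assms]]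
    by simp
qed

theorem theorem5p2:
  fixes c :: real
  assumes "0 < c" and "c \<le> 1 / 2"
  shows "\<exists>(n :: nat \<Rightarrow> nat) (F :: nat \<Rightarrow> nat pair_pre_digraph) (G :: nat \<Rightarrow> nat pair_pre_digraph).
           strict_mono n \<and>
           (\<forall>i. simple_graph_no_isolated (F i) \<and> card (pverts (F i)) = n i \<and>
                simple_graph_no_isolated (G i) \<and> card (pverts (G i)) = n i) \<and>
           (\<lambda>i. RH (F i) (G i) / real (n i)) \<longlonglongrightarrow> c"
proof -
  define n :: "nat \<Rightarrow> nat" where "n i = i + 2" for i
  define m where "m i = nat \<lfloor>2 * c * real (n i)\<rfloor>" for i
  define R where "R i = RH (clique_star (n i) 0) (clique_star (n i) (m i))" for i
  have n2: "2 \<le> n i" for i by (simp add: n_def)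
  have m_le: "real (m i) \<le> 2 * c * real (n i)" and m_gt: "2 * c * real (n i) - 1 < real (m i)" for i
    using assms(1) by (simp_all add: m_def)
  have m_n: "m i \<le> n i" for i
  proof -
    \<comment> \<open>The assumption c \<le> 1/2 makes the clique fit into n i vertices.\<close>
    have "2 * c * real (n i) \<le> 1 * real (n i)"
      using assms(2) by (intro mult_right_mono) auto
    with m_le[of i] have "real (m i) \<le> real (n i)" by linarith
    then show ?thesis by simp
  qed
  have "\<forall>i. norm (R i / real (n i) - c) \<le> 2 / real (n i)"
  proof
    fix i
    \<comment> \<open>Rounding shifts m / 2 down from c n by less than 1/2; with the 3/2 of the
      lower bound this makes 2.\<close>
    have "\<bar>R i - c * real (n i)\<bar> \<le> 2"
      using RH_clique_star_bounds[OF n2 m_n, of i] m_le[of i] m_gt[of i] unfolding R_def by linarith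
    moreover have "R i / real (n i) - c = (R i - c * real (n i)) / real (n i)"
      using n2[of i] by (simp add: field_simps)
    ultimately show "norm (R i / real (n i) - c) \<le> 2 / real (n i)"
      by (simp add: divide_right_mono)
  qed
  moreover have "(\<lambda>i. 2 / real (n i)) \<longlonglongrightarrow> 0"
    unfolding n_def by (rule LIMSEQ_ignore_initial_segment[OF lim_const_over_n])
  ultimately have "(\<lambda>i. R i / real (n i) - c) \<longlonglongrightarrow> 0"
    by (rule Lim_null_comparison[OF always_eventually])
  then have "(\<lambda>i. R i / real (n i)) \<longlonglongrightarrow> c"
    by (rule LIM_zero_cancel)
  moreover have "strict_mono n"
    by (simp add: n_def strict_mono_def)
  ultimately show ?thesis
    unfolding R_def using simple_graph_clique_star[OF n2]
    by (intro exI[of _ n] exI[of _ "\<lambda>i. clique_star (n i) 0"]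
        exI[of _ "\<lambda>i. clique_star (n i) (m i)"]) auto
qed

end
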